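(* There exist finite sets $V,W$ and hypergraphs $E_1,E_2\subseteq V\times W$ such that $E_1\simeq_{\rm q}E_2$ but $E_1\not\simeq_{\rm loc}E_2$.
   Context: A hypergraph is a subset $E\subseteq V\times W$ with $V,W$ finite sets. Put $V_1=V_2=V$, $W_1=W_2=W$. $E_1\leftrightarrow E_2=\{(v_2,w_1,v_1,w_2):(v_1,w_1)\in E_1\Leftrightarrow(v_2,w_2)\in E_2\}$. $\mathcal D_V$ is the algebra of complex diagonal $V\times V$ matrices with diagonal matrix units $\epsilon_{v,v}$; $VW=V\times W$. A channel is a positive trace-preserving linear map $\mathcal E:\mathcal D_V\to\mathcal D_W$; $\mathcal E(w|v)$ is the $(w,w)$ entry of $\mathcal E(\epsilon_{v,v})$. An NS correlation over $(V_2,W_1,V_1,W_2)$ is a channel $\Gamma:\mathcal D_{V_2W_1}\to\mathcal D_{V_1W_2}$ such that $\sum_{w_2}\Gamma(v_1,w_2|v_2,w_1)$ does not depend on $w_1$ and $\sum_{v_1}\Gamma(v_1,w_2|v_2,w_1)$ does not depend on $v_2$. An NS bicorrelation is an NS correlation $\Gamma$ that is unital ($\Gamma(I)=I$) and for which $\Gamma^*(v_2,w_1|v_1,w_2):=\Gamma(v_1,w_2|v_2,w_1)$ is an NS correlation over $(V_1,W_2,V_2,W_1)$. A quantum magic square over $V$ on a Hilbert space $H$ is a matrix $(E_{v,v'})_{v,v'\in V}$ of positive operators on $H$, each row and column of which sums to $I$. An NS bicorrelation $\Gamma$ is quantum if there are finite dimensional Hilbert spaces $H_A,H_B$, quantum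 magic squares $(E_{v_2,v_1})$ over $V$ on $H_A$ and $(F_{w_1,w_2})$ over $W$ on $H_B$ and a unit vector $\xi\in H_A\otimes H_B$ with $\Gamma(v_1,w_2|v_2,w_1)=\langle(E_{v_2,v_1}\otimes F_{w_1,w_2})\xi,\xi\rangle$; it is local if it is a convex combination of correlations $p^{(1)}(v_1|v_2)p^{(2)}(w_2|w_1)$ with $(p^{(1)}(v_1|v_2))$ and $(p^{(2)}(w_2|w_1))$ scalar bistochastic matrices. $E_1\simeq_{\rm q}E_2$ (resp. $E_1\simeq_{\rm loc}E_2$) means that there is a quantum (resp. local) bicorrelation $\Gamma$ with $\Gamma(v_1,w_2|v_2,w_1)=0$ whenever $(v_2,w_1,v_1,w_2)\notin E_1\leftrightarrow E_2$. *)

theory Defs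
  imports Complex_Main "Jordan_Normal_Form.Matrix" "Jordan_Normal_Form.Conjugate"
begin

section \<open>Hypergraphs\<close>

definition hypergraph :: "'v set \<Rightarrow> 'w set \<Rightarrow> ('v \<times> 'w) set \<Rightarrow> bool" where
  "hypergraph V W E \<longleftrightarrow> finite V \<and> finite W \<and> E \<subseteq> V \<times> W"

definition hyp_iff ::
  "'v set \<Rightarrow> 'w set \<Rightarrow> ('v \<times> 'w) set \<Rightarrow> ('v \<times> 'w) set \<Rightarrow> ('v \<times> 'w \<times> 'v \<times> 'w) set" where
  "hyp_iff V W E1 E2 =
     {(v2, w1, v1, w2). v2 \<in> V \<and> w1 \<in> W \<and> v1 \<in> V \<and> w2 \<in> W \<and>
        ((v1, w1) \<in> E1 \<longleftrightarrow> (v2, w2) \<in> E2)}"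

section \<open>Diagonal matrix algebras and channels\<close>

text \<open>Matrices indexed by an arbitrary finite set are functions of two indices, extended by
  zero outside the index set.\<close>

type_synonym 'v cmatrix = "'v \<Rightarrow> 'v \<Rightarrow> complex"

definition diag_alg :: "'v set \<Rightarrow> 'v cmatrix set" where
  "diag_alg V = {T. \<forall>x y. T x y \<noteq> 0 \<longrightarrow> x = y \<and> x \<in> V}"

definition diag_unit :: "'v \<Rightarrow> 'v cmatrix" where
  "diag_unit v = (\<lambda>x y. if x = v \<and> y = v then 1 else 0)"

definition id_cmatrix :: "'v set \<Rightarrow> 'v cmatrix" where
  "id_cmatrix V = (\<lambda>x y. if x = y \<and> x \<in> V then 1 else 0)"

definition trace_on :: "'v set \<Rightarrow> 'v cmatrix \<Rightarrow> complex" where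
  "trace_on V T = (\<Sum>x\<in>V. T x x)"

text \<open>The order on the complex numbers is the one for which \<open>0 \<le> z\<close> says that \<open>z\<close> is real and
  nonnegative.\<close>

definition positive_on :: "'v set \<Rightarrow> 'v cmatrix \<Rightarrow> bool" where
  "positive_on V T \<longleftrightarrow> (\<forall>\<xi>. 0 \<le> (\<Sum>x\<in>V. \<Sum>y\<in>V. T x y * \<xi> y * cnj (\<xi> x)))"

definition channel :: "'v set \<Rightarrow> 'w set \<Rightarrow> ('v cmatrix \<Rightarrow> 'w cmatrix) \<Rightarrow> bool" where
  "channel V W \<E> \<longleftrightarrow>
     (\<forall>T \<in> diag_alg V. \<E> T \<in> diag_alg W) \<and>
     (\<forall>S \<in> diag_alg V. \<forall>T \<in> diag_alg V.
        \<E> (\<lambda>x y. S x y + T x y) = (\<lambda>x y. \<E> S x y + \<E> T x y)) \<and>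
     (\<forall>c. \<forall>T \<in> diag_alg V. \<E> (\<lambda>x y. c * T x y) = (\<lambda>x y. c * \<E> T x y)) \<and>
     (\<forall>T \<in> diag_alg V. positive_on V T \<longrightarrow> positive_on W (\<E> T)) \<and>
     (\<forall>T \<in> diag_alg V. trace_on W (\<E> T) = trace_on V T)"

text \<open>\<open>kernel \<E> w v\<close> is $\mathcal E(w|v)$.\<close>

definition kernel :: "('v cmatrix \<Rightarrow> 'w cmatrix) \<Rightarrow> 'w \<Rightarrow> 'v \<Rightarrow> complex" where
  "kernel \<E> w v = \<E> (diag_unit v) w w"

text \<open>The linear map from \<open>diag_alg W\<close> to \<open>diag_alg V\<close> whose kernel is the transpose
  of that of \<open>\<E>\<close>.\<close>

definition dual_map ::
  "'v set \<Rightarrow> 'w set \<Rightarrow> ('v cmatrix \<Rightarrow> 'w cmatrix) \<Rightarrow> ('w cmatrix \<Rightarrow> 'v cmatrix)" where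
  "dual_map V W \<E> T =
     (\<lambda>x y. if x = y \<and> x \<in> V then (\<Sum>w\<in>W. kernel \<E> w x * T w w) else 0)"

section \<open>No-signalling correlations and bicorrelations\<close>

text \<open>\<open>ns_correlation X2 Y1 X1 Y2 \<Gamma>\<close> says that \<open>\<Gamma>\<close> is an NS correlation over the quadruple
  \<open>(X2, Y1, X1, Y2)\<close>: inputs in \<open>X2 \<times> Y1\<close>, outputs in \<open>X1 \<times> Y2\<close>.\<close>

definition ns_correlation ::
  "'x2 set \<Rightarrow> 'y1 set \<Rightarrow> 'x1 set \<Rightarrow> 'y2 set \<Rightarrow>
     (('x2 \<times> 'y1) cmatrix \<Rightarrow> ('x1 \<times> 'y2) cmatrix) \<Rightarrow> bool" where
  "ns_correlation X2 Y1 X1 Y2 \<Gamma> \<longleftrightarrow>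
     channel (X2 \<times> Y1) (X1 \<times> Y2) \<Gamma> \<and>
     (\<forall>x2\<in>X2. \<forall>x1\<in>X1. \<forall>y1\<in>Y1. \<forall>y1'\<in>Y1.
        (\<Sum>y2\<in>Y2. kernel \<Gamma> (x1, y2) (x2, y1)) = (\<Sum>y2\<in>Y2. kernel \<Gamma> (x1, y2) (x2, y1'))) \<and>
     (\<forall>y1\<in>Y1. \<forall>y2\<in>Y2. \<forall>x2\<in>X2. \<forall>x2'\<in>X2.
        (\<Sum>x1\<in>X1. kernel \<Gamma> (x1, y2) (x2, y1)) = (\<Sum>x1\<in>X1. kernel \<Gamma> (x1, y2) (x2', y1)))"

definition ns_bicorrelation ::
  "'v set \<Rightarrow> 'w set \<Rightarrow> (('v \<times> 'w) cmatrix \<Rightarrow> ('v \<times> 'w) cmatrix) \<Rightarrow> bool" where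
  "ns_bicorrelation V W \<Gamma> \<longleftrightarrow>
     ns_correlation V W V W \<Gamma> \<and>
     \<Gamma> (id_cmatrix (V \<times> W)) = id_cmatrix (V \<times> W) \<and>
     ns_correlation V W V W (dual_map (V \<times> W) (V \<times> W) \<Gamma>)"

section \<open>Quantum bicorrelations\<close>

text \<open>Finite dimensional Hilbert spaces are taken to be $\mathbb C^n$, operators being
  \<open>n \<times> n\<close> matrices.\<close>

definition positive_op :: "nat \<Rightarrow> complex mat \<Rightarrow> bool" where
  "positive_op n A \<longleftrightarrow>
     A \<in> carrier_mat n n \<and> (\<forall>\<xi> \<in> carrier_vec n. 0 \<le> (A *\<^sub>v \<xi>) \<bullet>c \<xi>)"

definition op_sum :: "nat \<Rightarrow> ('i \<Rightarrow> complex mat) \<Rightarrow> 'i set \<Rightarrow> complex mat" where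
  "op_sum n A I = mat n n (\<lambda>(i, j). \<Sum>k\<in>I. A k $$ (i, j))"

definition quantum_magic_square :: "'v set \<Rightarrow> nat \<Rightarrow> ('v \<Rightarrow> 'v \<Rightarrow> complex mat) \<Rightarrow> bool" where
  "quantum_magic_square V n E \<longleftrightarrow>
     (\<forall>v\<in>V. \<forall>v'\<in>V. positive_op n (E v v')) \<and>
     (\<forall>v\<in>V. op_sum n (\<lambda>v'. E v v') V = 1\<^sub>m n) \<and>
     (\<forall>v'\<in>V. op_sum n (\<lambda>v. E v v') V = 1\<^sub>m n)"

text \<open>Kronecker product: $\mathbb C^m \otimes \mathbb C^n$ is identified with $\mathbb C^{mn}$
  by letting $e_i \otimes e_j$ correspond to $e_{i n + j}$.\<close>

definition tensor_mat :: "complex mat \<Rightarrow> complex mat \<Rightarrow> complex mat" where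
  "tensor_mat A B = mat (dim_row A * dim_row B) (dim_col A * dim_col B)
     (\<lambda>(i, j). A $$ (i div dim_row B, j div dim_col B) * B $$ (i mod dim_row B, j mod dim_col B))"

definition quantum_bicorrelation ::
  "'v set \<Rightarrow> 'w set \<Rightarrow> (('v \<times> 'w) cmatrix \<Rightarrow> ('v \<times> 'w) cmatrix) \<Rightarrow> bool" where
  "quantum_bicorrelation V W \<Gamma> \<longleftrightarrow>
     ns_bicorrelation V W \<Gamma> \<and>
     (\<exists>m n E F \<xi>.
        quantum_magic_square V m E \<and> quantum_magic_square W n F \<and>
        \<xi> \<in> carrier_vec (m * n) \<and> \<xi> \<bullet>c \<xi> = 1 \<and>
        (\<forall>v1\<in>V. \<forall>w2\<in>W. \<forall>v2\<in>V. \<forall>w1\<in>W.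
           kernel \<Gamma> (v1, w2) (v2, w1) = (tensor_mat (E v2 v1) (F w1 w2) *\<^sub>v \<xi>) \<bullet>c \<xi>))"

section \<open>Local bicorrelations\<close>

text \<open>\<open>p a b\<close> stands for $p(a|b)$.\<close>

definition bistochastic :: "'v set \<Rightarrow> ('v \<Rightarrow> 'v \<Rightarrow> real) \<Rightarrow> bool" where
  "bistochastic V p \<longleftrightarrow>
     (\<forall>a\<in>V. \<forall>b\<in>V. 0 \<le> p a b) \<and>
     (\<forall>a\<in>V. (\<Sum>b\<in>V. p a b) = 1) \<and>
     (\<forall>b\<in>V. (\<Sum>a\<in>V. p a b) = 1)"

definition local_bicorrelation ::
  "'v set \<Rightarrow> 'w set \<Rightarrow> (('v \<times> 'w) cmatrix \<Rightarrow> ('v \<times> 'w) cmatrix) \<Rightarrow> bool" where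
  "local_bicorrelation V W \<Gamma> \<longleftrightarrow>
     ns_bicorrelation V W \<Gamma> \<and>
     (\<exists>(n::nat) (c :: nat \<Rightarrow> real) p q.
        (\<forall>k<n. 0 \<le> c k \<and> bistochastic V (p k) \<and> bistochastic W (q k)) \<and>
        (\<Sum>k<n. c k) = 1 \<and>
        (\<forall>v1\<in>V. \<forall>w2\<in>W. \<forall>v2\<in>V. \<forall>w1\<in>W.
           kernel \<Gamma> (v1, w2) (v2, w1) = complex_of_real (\<Sum>k<n. c k * (p k v1 v2 * q k w2 w1))))"

section \<open>Quantum and local isomorphism of hypergraphs\<close>

definition supported_on_iff ::
  "'v set \<Rightarrow> 'w set \<Rightarrow> ('v \<times> 'w) set \<Rightarrow> ('v \<times> 'w) set \<Rightarrow>
     (('v \<times> 'w) cmatrix \<Rightarrow> ('v \<times> 'w) cmatrix) \<Rightarrow> bool" where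
  "supported_on_iff V W E1 E2 \<Gamma> \<longleftrightarrow>
     (\<forall>v2\<in>V. \<forall>w1\<in>W. \<forall>v1\<in>V. \<forall>w2\<in>W.
        (v2, w1, v1, w2) \<notin> hyp_iff V W E1 E2 \<longrightarrow> kernel \<Gamma> (v1, w2) (v2, w1) = 0)"

definition q_isomorphic :: "'v set \<Rightarrow> 'w set \<Rightarrow> ('v \<times> 'w) set \<Rightarrow> ('v \<times> 'w) set \<Rightarrow> bool" where
  "q_isomorphic V W E1 E2 \<longleftrightarrow>
     (\<exists>\<Gamma>. quantum_bicorrelation V W \<Gamma> \<and> supported_on_iff V W E1 E2 \<Gamma>)"

definition loc_isomorphic :: "'v set \<Rightarrow> 'w set \<Rightarrow> ('v \<times> 'w) set \<Rightarrow> ('v \<times> 'w) set \<Rightarrow> bool" where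
  "loc_isomorphic V W E1 E2 \<longleftrightarrow>
     (\<exists>\<Gamma>. local_bicorrelation V W \<Gamma> \<and> supported_on_iff V W E1 E2 \<Gamma>)"

end

theory Submission
  imports Defs
begin

text \<open>The hypergraphs encode the Mermin--Peres magic square game. Vertices are the even sign
  vectors of the three rows, hyperedge indices those of the three columns, and incidence means
  agreement at the common cell for the first hypergraph, disagreement for the second. A local
  isomorphism carries bicliques to bicliques of at least the same size, since the support of a
  bistochastic matrix does not shrink sets. The first hypergraph contains a $3 \times 3$ biclique
  (all signs positive); in the second one such a biclique would have one vertex in each row and
  one index in each column, hence would fill the square with signs whose row products are $1$ and
  whose column products are $-1$. Operators on $\mathbb C^2 \otimes \mathbb C^2$ can fill it in
  this way, and their joint eigenprojections applied to a maximally entangled vector give the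
  quantum isomorphism.\<close>

section \<open>Maps given by a kernel\<close>

text \<open>The output is cut to zero off the diagonal and outside \<open>W\<close> for every
  argument, so kernels that agree on the index sets give equal functions, not only equal
  restrictions to \<open>diag_alg V\<close>.\<close>

definition kernel_map :: "'v set \<Rightarrow> 'w set \<Rightarrow> ('w \<Rightarrow> 'v \<Rightarrow> complex) \<Rightarrow> 'v cmatrix \<Rightarrow> 'w cmatrix" where
  "kernel_map V W k T = (\<lambda>x y. if x = y \<and> x \<in> W then (\<Sum>v\<in>V. k x v * T v v) else 0)"

lemma kernel_kernel_map:
  assumes "finite V" "v \<in> V" "w \<in> W"
  shows "kernel (kernel_map V W k) w v = k w v"
proof -
  have "kernel (kernel_map V W k) w v = (\<Sum>u\<in>V. if u = v then k w u else 0)"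
    unfolding kernel_def kernel_map_def diag_unit_def
    using assms(3) by (simp, intro sum.cong refl) simp
  then show ?thesis using assms by simp
qed

text \<open>Hence for \<open>V = W\<close> a symmetric kernel gives a map that is its own
  dual.\<close>

lemma dual_map_kernel_map:
  assumes "finite V"
  shows "dual_map V W (kernel_map V W k) = kernel_map W V (\<lambda>v w. k w v)"
  unfolding dual_map_def kernel_map_def[of W V]
  using assms by (auto simp: fun_eq_iff kernel_kernel_map intro!: sum.cong)

lemma positive_on_diagonal:
  assumes "finite V" "positive_on V T" "v \<in> V"
  shows "0 \<le> T v v"
proof -
  define e :: "'a \<Rightarrow> complex" where "e = (\<lambda>x. if x = v then 1 else 0)"
  have "0 \<le> (\<Sum>x\<in>V. \<Sum>y\<in>V. T x y * e y * cnj (e x))"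
    using assms(2) by (simp add: positive_on_def)
  also have "\<dots> = (\<Sum>x\<in>V. \<Sum>y\<in>V. if y = v then (if x = v then T x y else 0) else 0)"
    by (intro sum.cong refl) (simp add: e_def)
  also have "\<dots> = T v v" using assms by simp
  finally show ?thesis .
qed

lemma positive_on_diagonalI:
  assumes "finite V" "T \<in> diag_alg V" "\<And>v. v \<in> V \<Longrightarrow> 0 \<le> T v v"
  shows "positive_on V T"
  unfolding positive_on_def
proof
  fix \<xi> :: "'a \<Rightarrow> complex"
  have "(\<Sum>x\<in>V. \<Sum>y\<in>V. T x y * \<xi> y * cnj (\<xi> x)) =
      (\<Sum>x\<in>V. \<Sum>y\<in>V. if y = x then T x x * \<xi> x * cnj (\<xi> x) else 0)"
    using assms(2) by (intro sum.cong refl) (auto simp: diag_alg_def)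
  also have "\<dots> = (\<Sum>x\<in>V. T x x * (\<xi> x * cnj (\<xi> x)))"
    using assms(1) by (simp add: mult.assoc)
  also have "\<dots> \<ge> 0"
  proof (rule sum_nonneg)
    fix x assume "x \<in> V"
    moreover have "0 \<le> \<xi> x * cnj (\<xi> x)"
      by (simp add: complex_mult_cnj less_eq_complex_def)
    ultimately show "0 \<le> T x x * (\<xi> x * cnj (\<xi> x))"
      using assms(3) mult_nonneg_nonneg by blast
  qed
  finally show "0 \<le> (\<Sum>x\<in>V. \<Sum>y\<in>V. T x y * \<xi> y * cnj (\<xi> x))" .
qed

text \<open>A diagonal matrix is positive iff its diagonal entries are nonnegative, so a stochastic
  kernel is enough for a channel.\<close>

lemma channel_kernel_map:
  assumes fin: "finite V" "finite W"
    and nonneg: "\<And>v w. v \<in> V \<Longrightarrow> w \<in> W \<Longrightarrow> 0 \<le> k w v"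
    and total: "\<And>v. v \<in> V \<Longrightarrow> (\<Sum>w\<in>W. k w v) = 1"
  shows "channel V W (kernel_map V W k)"
  unfolding channel_def
proof (intro conjI ballI allI impI)
  show diag: "kernel_map V W k T \<in> diag_alg W" for T
    by (simp add: kernel_map_def diag_alg_def)
  show "kernel_map V W k (\<lambda>x y. S x y + T x y) =
      (\<lambda>x y. kernel_map V W k S x y + kernel_map V W k T x y)" for S T
    by (auto simp: kernel_map_def fun_eq_iff distrib_left sum.distrib)
  show "kernel_map V W k (\<lambda>x y. c * T x y) = (\<lambda>x y. c * kernel_map V W k T x y)" for c T
    by (auto simp: kernel_map_def fun_eq_iff sum_distrib_left mult_ac)
  show "positive_on W (kernel_map V W k T)" if "T \<in> diag_alg V" "positive_on V T" for T
    using positive_on_diagonal[OF fin(1) that(2)]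
    by (intro positive_on_diagonalI fin diag)
       (auto simp: kernel_map_def intro!: sum_nonneg mult_nonneg_nonneg nonneg)
  show "trace_on W (kernel_map V W k T) = trace_on V T" for T
  proof -
    have "trace_on W (kernel_map V W k T) = (\<Sum>w\<in>W. \<Sum>v\<in>V. k w v * T v v)"
      by (simp add: trace_on_def kernel_map_def)
    also have "\<dots> = (\<Sum>v\<in>V. (\<Sum>w\<in>W. k w v) * T v v)"
      by (subst sum.swap) (simp add: sum_distrib_right)
    finally show ?thesis by (simp add: trace_on_def total)
  qed
qed

section \<open>Positive operators and the maximally entangled vector\<close>

text \<open>The hypothesis reads P = P^* P, which makes the quadratic form at \<open>\<xi>\<close>
  the squared norm of P applied to \<open>\<xi>\<close>. Orthogonal projections satisfy it, and it
  can be checked entry by entry.\<close>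

lemma positive_op_Gram:
  assumes "\<And>i j. i < n \<Longrightarrow> j < n \<Longrightarrow> P i j = (\<Sum>k<n. cnj (P k i) * P k j)"
  shows "positive_op n (mat n n (\<lambda>(i, j). P i j))"
  unfolding positive_op_def
proof (intro conjI ballI)
  fix \<xi> :: "complex vec" assume \<xi>: "\<xi> \<in> carrier_vec n"
  define y where "y = (\<lambda>k. \<Sum>j<n. P k j * \<xi> $ j)"
  have "(mat n n (\<lambda>(i, j). P i j) *\<^sub>v \<xi>) \<bullet>c \<xi> =
      (\<Sum>i<n. (\<Sum>j<n. P i j * \<xi> $ j) * cnj (\<xi> $ i))"
    using \<xi> by (simp add: scalar_prod_def atLeast0LessThan)
  also have "\<dots> = (\<Sum>i<n. \<Sum>j<n. \<Sum>k<n. cnj (P k i * \<xi> $ i) * (P k j * \<xi> $ j))"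
  proof (rule sum.cong[OF refl])
    fix i assume i: "i \<in> {..<n}"
    have "(\<Sum>j<n. P i j * \<xi> $ j) = (\<Sum>j<n. (\<Sum>k<n. cnj (P k i) * P k j) * \<xi> $ j)"
      using i by (intro sum.cong refl arg_cong2[where f = "(*)"] assms) auto
    then show "(\<Sum>j<n. P i j * \<xi> $ j) * cnj (\<xi> $ i) =
        (\<Sum>j<n. \<Sum>k<n. cnj (P k i * \<xi> $ i) * (P k j * \<xi> $ j))"
      by (simp add: sum_distrib_left sum_distrib_right mult_ac)
  qed
  also have "\<dots> = (\<Sum>i<n. \<Sum>k<n. \<Sum>j<n. cnj (P k i * \<xi> $ i) * (P k j * \<xi> $ j))"
    by (intro sum.cong refl sum.swap)
  also have "\<dots> = (\<Sum>k<n. \<Sum>i<n. \<Sum>j<n. cnj (P k i * \<xi> $ i) * (P k j * \<xi> $ j))"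
    by (rule sum.swap)
  also have "\<dots> = (\<Sum>k<n. cnj (y k) * y k)"
    by (simp add: y_def sum_product)
  also have "\<dots> \<ge> 0"
    by (intro sum_nonneg) (simp add: less_eq_complex_def)
  finally show "0 \<le> (mat n n (\<lambda>(i, j). P i j) *\<^sub>v \<xi>) \<bullet>c \<xi>" .
qed simp

text \<open>This is n^(-1/2) times the sum of the e_i tensor e_i: the indices with equal quotient
  and remainder are the \<open>i * n + i\<close>.\<close>

definition max_entangled :: "nat \<Rightarrow> complex vec" where
  "max_entangled n = vec (n * n) (\<lambda>k. if k div n = k mod n then 1 / complex_of_real (sqrt n) else 0)"

lemma sum_max_entangled:
  fixes f :: "nat \<Rightarrow> complex"
  shows "(\<Sum>k<n * n. f k * max_entangled n $ k) = (\<Sum>i<n. f (i * n + i)) / complex_of_real (sqrt n)"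
proof -
  have "(\<Sum>k<n * n. f k * max_entangled n $ k) =
      (\<Sum>i<n. \<Sum>k\<in>{i * n..<i * n + n}. f k * max_entangled n $ k)"
    by (simp add: sum.nat_group)
  also have "\<dots> = (\<Sum>i<n. \<Sum>j<n. f (i * n + j) * max_entangled n $ (i * n + j))"
  proof (rule sum.cong[OF refl])
    fix i
    show "(\<Sum>k\<in>{i * n..<i * n + n}. f k * max_entangled n $ k) =
        (\<Sum>j<n. f (i * n + j) * max_entangled n $ (i * n + j))"
      using sum.shift_bounds_nat_ivl[of "\<lambda>k. f k * max_entangled n $ k" 0 "i * n" n]
      by (simp add: add.commute atLeast0LessThan)
  qed
  also have "\<dots> = (\<Sum>i<n. \<Sum>j<n. if j = i then f (i * n + i) / complex_of_real (sqrt n) else 0)"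
  proof (intro sum.cong refl)
    fix i j assume ij: "i \<in> {..<n}" "j \<in> {..<n}"
    \<comment> \<open>The index must be seen to lie below \<open>n * n\<close>, since
      \<open>vec\<close> specifies no entries beyond its dimension.\<close>
    then have "(i + 1) * n \<le> n * n" by (intro mult_right_mono) auto
    then have "i * n + j < n * n" using ij by simp
    then show "f (i * n + j) * max_entangled n $ (i * n + j) =
        (if j = i then f (i * n + i) / complex_of_real (sqrt n) else 0)"
      using ij by (auto simp: max_entangled_def)
  qed
  finally show ?thesis by (simp add: sum_divide_distrib)
qed

lemma cnj_max_entangled:
  "k < n * n \<Longrightarrow> cnj (max_entangled n $ k) = max_entangled n $ k"
  by (simp add: max_entangled_def)

lemma max_entangled_unit:
  assumes "n > 0"
  shows "max_entangled n \<bullet>c max_entangled n = 1"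
proof -
  have "max_entangled n \<bullet>c max_entangled n =
      (\<Sum>k<n * n. max_entangled n $ k * max_entangled n $ k)"
    unfolding scalar_prod_def
    by (auto simp: max_entangled_def atLeast0LessThan intro!: sum.cong)
  also have "\<dots> = (\<Sum>i<n. max_entangled n $ (i * n + i)) / complex_of_real (sqrt n)"
    by (rule sum_max_entangled)
  also have "(\<Sum>i<n. max_entangled n $ (i * n + i)) = (\<Sum>i<n. 1 / complex_of_real (sqrt n))"
  proof (intro sum.cong refl)
    fix i assume i: "i \<in> {..<n}"
    then have "(i + 1) * n \<le> n * n" by (intro mult_right_mono) auto
    then have "i * n + i < n * n" using i by simp
    then show "max_entangled n $ (i * n + i) = 1 / complex_of_real (sqrt n)"
      using i by (simp add: max_entangled_def)
  qed
  also have "(\<Sum>i<n. 1 / complex_of_real (sqrt n)) / complex_of_real (sqrt n) = of_nat n / (complex_of_real (sqrt n))\<^sup>2"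
    by (simp add: power2_eq_square field_simps)
  also have "\<dots> = 1" using assms by (simp flip: of_real_power)
  finally show ?thesis .
qed

text \<open>Rows and columns both collapse to the indices \<open>i * n + i\<close>. The value is the
  normalised trace of \<open>A\<close> times the transpose of \<open>B\<close>.\<close>

lemma tensor_mat_max_entangled:
  assumes "A \<in> carrier_mat n n" "B \<in> carrier_mat n n"
  shows "(tensor_mat A B *\<^sub>v max_entangled n) \<bullet>c max_entangled n =
    (\<Sum>i<n. \<Sum>j<n. A $$ (i, j) * B $$ (i, j)) / of_nat n"
proof -
  have dim: "dim_vec (max_entangled n) = n * n" by (simp add: max_entangled_def)
  have lt: "i * n + i < n * n" if "i < n" for i
  proof -
    have "(i + 1) * n \<le> n * n" using that by (intro mult_right_mono) auto
    then show ?thesis using that by simp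
  qed
  define T where "T = tensor_mat A B"
  have T: "T \<in> carrier_mat (n * n) (n * n)"
    using assms by (simp add: T_def tensor_mat_def)
  have entry: "T $$ (i * n + i, j * n + j) = A $$ (i, j) * B $$ (i, j)" if "i < n" "j < n" for i j
    using that assms lt by (simp add: T_def tensor_mat_def)
  have "(T *\<^sub>v max_entangled n) \<bullet>c max_entangled n =
      (\<Sum>k<n * n. (\<Sum>l<n * n. T $$ (k, l) * max_entangled n $ l) * max_entangled n $ k)"
    using T dim by (simp add: scalar_prod_def atLeast0LessThan cnj_max_entangled)
  also have "\<dots> = (\<Sum>i<n. \<Sum>j<n. T $$ (i * n + i, j * n + j)) / (complex_of_real (sqrt n))\<^sup>2"
    unfolding sum_max_entangled by (simp add: power2_eq_square flip: sum_divide_distrib)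
  also have "\<dots> = (\<Sum>i<n. \<Sum>j<n. A $$ (i, j) * B $$ (i, j)) / of_nat n"
    using entry by (simp flip: of_real_power)
  finally show ?thesis by (simp add: T_def)
qed

section \<open>Supports of bistochastic matrices\<close>

lemma bistochastic_transpose: "bistochastic V p \<Longrightarrow> bistochastic V (\<lambda>a b. p b a)"
  by (auto simp: bistochastic_def)

text \<open>Double counting: the rows in \<open>A\<close> carry total mass \<open>card A\<close>,
  all of it in the columns they reach, and each column has mass one.\<close>

lemma bistochastic_card_le:
  assumes "finite V" "bistochastic V p" "A \<subseteq> V"
  shows "card A \<le> card {b \<in> V. \<exists>a\<in>A. 0 < p a b}"
proof -
  let ?B = "{b \<in> V. \<exists>a\<in>A. 0 < p a b}"
  have nn: "0 \<le> p a b" if "a \<in> V" "b \<in> V" for a b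
    using assms(2) that by (simp add: bistochastic_def)
  have "real (card A) = (\<Sum>a\<in>A. \<Sum>b\<in>V. p a b)"
  proof -
    have "(\<Sum>b\<in>V. p a b) = 1" if "a \<in> A" for a
      using assms(2,3) that unfolding bistochastic_def by blast
    then show ?thesis by simp
  qed
  also have "\<dots> = (\<Sum>a\<in>A. \<Sum>b\<in>?B. p a b)"
  proof (rule sum.cong[OF refl])
    fix a assume a: "a \<in> A"
    show "(\<Sum>b\<in>V. p a b) = (\<Sum>b\<in>?B. p a b)"
    proof (rule sum.mono_neutral_right)
      show "\<forall>b\<in>V - ?B. p a b = 0"
      proof
        fix b assume b: "b \<in> V - ?B"
        then have "\<not> 0 < p a b" using a by blast
        moreover have "0 \<le> p a b" using nn a b assms(3) by blast
        ultimately show "p a b = 0" by simp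
      qed
    qed (use assms(1) in auto)
  qed
  also have "\<dots> = (\<Sum>b\<in>?B. \<Sum>a\<in>A. p a b)" by (rule sum.swap)
  also have "\<dots> \<le> (\<Sum>b\<in>?B. \<Sum>a\<in>V. p a b)"
  proof (rule sum_mono)
    fix b assume "b \<in> ?B"
    then show "(\<Sum>a\<in>A. p a b) \<le> (\<Sum>a\<in>V. p a b)"
      using nn by (intro sum_mono2 assms(1,3)) blast
  qed
  also have "\<dots> = (\<Sum>b\<in>?B. 1)"
    using assms(2) unfolding bistochastic_def by (intro sum.cong refl) blast
  finally show ?thesis by simp
qed

text \<open>One product term with nonzero weight suffices: \<open>A'\<close> and \<open>B'\<close>
  are the sets reached from \<open>A\<close> and \<open>B\<close> through the supports of its two
  bistochastic factors.\<close>

lemma loc_isomorphic_biclique: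
  assumes "finite V" "finite W" "loc_isomorphic V W E1 E2"
    and "A \<subseteq> V" "B \<subseteq> W" "A \<times> B \<subseteq> E1"
  obtains A' B' where "A' \<subseteq> V" "B' \<subseteq> W" "card A \<le> card A'" "card B \<le> card B'" "A' \<times> B' \<subseteq> E2"
proof -
  obtain \<Gamma> where loc: "local_bicorrelation V W \<Gamma>" and supp: "supported_on_iff V W E1 E2 \<Gamma>"
    using assms(3) by (auto simp: loc_isomorphic_def)
  obtain n :: nat and c :: "nat \<Rightarrow> real" and p q where
    bi: "\<forall>k<n. 0 \<le> c k \<and> bistochastic V (p k) \<and> bistochastic W (q k)"
    and one: "(\<Sum>k<n. c k) = 1"
    and ker: "\<forall>v1\<in>V. \<forall>w2\<in>W. \<forall>v2\<in>V. \<forall>w1\<in>W.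
      kernel \<Gamma> (v1, w2) (v2, w1) = complex_of_real (\<Sum>k<n. c k * (p k v1 v2 * q k w2 w1))"
    using loc unfolding local_bicorrelation_def by (elim conjE exE)
  obtain k where k: "k < n" "c k \<noteq> 0"
  proof -
    have "\<not> (\<forall>k\<in>{..<n}. c k = 0)"
    proof
      assume "\<forall>k\<in>{..<n}. c k = 0"
      then have "(\<Sum>k<n. c k) = 0" by (rule sum.neutral)
      with one show False by simp
    qed
    then show ?thesis using that by blast
  qed
  have pk: "bistochastic V (p k)" and qk: "bistochastic W (q k)" using bi k(1) by blast+
  \<comment> \<open>A vanishing sum of nonnegative terms has vanishing terms, so the support
    condition passes from \<open>\<Gamma>\<close> to the \<open>k\<close>-th product.\<close>
  have zero: "p k v1 v2 * q k w2 w1 = 0"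
    if "v1 \<in> V" "w2 \<in> W" "v2 \<in> V" "w1 \<in> W" "(v1, w1) \<in> E1" "(v2, w2) \<notin> E2" for v1 v2 w1 w2
  proof -
    have "kernel \<Gamma> (v1, w2) (v2, w1) = 0"
      using supp that by (simp add: supported_on_iff_def hyp_iff_def)
    moreover have "kernel \<Gamma> (v1, w2) (v2, w1) =
        complex_of_real (\<Sum>k<n. c k * (p k v1 v2 * q k w2 w1))"
      using ker that(1-4) by blast
    ultimately have "(\<Sum>k<n. c k * (p k v1 v2 * q k w2 w1)) = 0"
      by (metis of_real_eq_0_iff)
    moreover have "0 \<le> c l * (p l v1 v2 * q l w2 w1)" if "l \<in> {..<n}" for l
    proof -
      have "0 \<le> c l" "bistochastic V (p l)" "bistochastic W (q l)" using bi that by auto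
      then have "0 \<le> c l" "0 \<le> p l v1 v2" "0 \<le> q l w2 w1"
        using \<open>v1 \<in> V\<close> \<open>v2 \<in> V\<close> \<open>w1 \<in> W\<close> \<open>w2 \<in> W\<close> unfolding bistochastic_def by blast+
      then show ?thesis by simp
    qed
    ultimately have "c k * (p k v1 v2 * q k w2 w1) = 0"
      using k(1) sum_nonneg_eq_0_iff[of "{..<n}" "\<lambda>l. c l * (p l v1 v2 * q l w2 w1)"] by blast
    then show ?thesis using k(2) by simp
  qed
  show thesis
  proof
    show "card A \<le> card {b \<in> V. \<exists>a\<in>A. 0 < p k a b}"
      by (rule bistochastic_card_le[OF assms(1) pk assms(4)])
    \<comment> \<open>The \<open>E1\<close> side is the first argument of \<open>p k\<close> but the
      second of \<open>q k\<close>, hence the transpose.\<close>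
    show "card B \<le> card {b \<in> W. \<exists>a\<in>B. 0 < q k b a}"
      by (rule bistochastic_card_le[OF assms(2) bistochastic_transpose[OF qk] assms(5)])
    show "{b \<in> V. \<exists>a\<in>A. 0 < p k a b} \<times> {b \<in> W. \<exists>a\<in>B. 0 < q k b a} \<subseteq> E2"
    proof clarify
      fix v2 w2 v1 w1
      assume v: "v2 \<in> V" "v1 \<in> A" "0 < p k v1 v2" and w: "w2 \<in> W" "w1 \<in> B" "0 < q k w2 w1"
      then have "v1 \<in> V" "w1 \<in> W" "(v1, w1) \<in> E1" using assms(4-6) by auto
      from zero[OF this(1) w(1) v(1) this(2,3)] show "(v2, w2) \<in> E2" using v(3) w(3) by auto
    qed
  qed auto
qed

section \<open>The hypergraphs of the magic square\<close>

text \<open>The vertex \<open>4 * r + a\<close> with \<open>r < 3\<close>, \<open>a < 4\<close> stands for the \<open>a\<close>-th of the four vectors in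
  $\{1,-1\}^3$ with product $1$, placed in row \<open>r\<close> (column \<open>r\<close> if the vertex is a hyperedge
  index) of the square; \<open>entry v c\<close> is its \<open>c\<close>-th coordinate.\<close>

definition entry :: "nat \<Rightarrow> nat \<Rightarrow> complex" where
  "entry v c = (if v mod 4 = 0 \<or> v mod 4 = Suc c then 1 else - 1)"

text \<open>A row vertex \<open>v\<close> and a column index \<open>w\<close> meet in the cell at
  row \<open>v div 4\<close> and column \<open>w div 4\<close>; the two entries compared are the
  signs that they put there.\<close>

definition agreeing :: "(nat \<times> nat) set" where
  "agreeing = {(v, w). v < 12 \<and> w < 12 \<and> entry v (w div 4) = entry w (v div 4)}"

definition disagreeing :: "(nat \<times> nat) set" where
  "disagreeing = {(v, w). v < 12 \<and> w < 12 \<and> entry v (w div 4) \<noteq> entry w (v div 4)}"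

section \<open>Combinatorics of even sign vectors\<close>

lemma entry_cases: "entry v c = 1 \<or> entry v c = - 1"
  by (simp add: entry_def)

lemma less_3_cases: "(n::nat) < 3 \<Longrightarrow> n = 0 \<or> n = 1 \<or> n = 2"
  by arith

lemma less_4_cases: "(n::nat) < 4 \<Longrightarrow> n = 0 \<or> n = 1 \<or> n = 2 \<or> n = 3"
  by arith

lemma entry_prod: "entry v 0 * entry v 1 * entry v 2 = 1"
  using less_4_cases[of "v mod 4"] by (auto simp: entry_def)

text \<open>The coordinatewise product of two distinct even vectors is even and not constantly 1, so
  it equals 1 at just one of the three coordinates.\<close>

lemma entry_agree_unique:
  assumes "v mod 4 \<noteq> v' mod 4" "c < 3" "c' < 3" "entry v c = entry v' c" "entry v c' = entry v' c'"
  shows "c = c'"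
proof -
  have "v mod 4 < 4" "v' mod 4 < 4" by simp_all
  from less_4_cases[OF this(1)] less_4_cases[OF this(2)] less_3_cases[OF assms(2)]
    less_3_cases[OF assms(3)] assms(1,4,5)
  show ?thesis unfolding entry_def by (elim disjE; simp)
qed

lemma entry_card:
  assumes "c < 3"
  shows "card {a. a < 4 \<and> entry a c = t} \<le> 2"
proof -
  have "{a. a < 4 \<and> entry a c = t} \<subseteq> (if t = 1 then {0, Suc c} else {1, 2, 3} - {Suc c})"
    using less_4_cases by (auto simp: entry_def)
  then have "card {a. a < 4 \<and> entry a c = t} \<le> card (if t = 1 then {0, Suc c} else {1, 2, 3} - {Suc c})"
    by (intro card_mono) auto
  also have "\<dots> \<le> 2" using less_3_cases[OF assms] by auto
  finally show ?thesis .
qed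

text \<open>Two vertices of \<open>A\<close> in one row would agree in the column of every
  \<open>w\<close> in \<open>B\<close>, which forces \<open>B\<close> into a single column with a
  prescribed sign in that row; only two vectors remain. The hypotheses are symmetric enough to swap
  rows and columns.\<close>

lemma biclique_inj_on:
  assumes "A \<subseteq> {..<12}" "B \<subseteq> {..<12}" "3 \<le> card B"
    and opp: "\<And>v w. v \<in> A \<Longrightarrow> w \<in> B \<Longrightarrow> entry v (w div 4) \<noteq> entry w (v div 4)"
  shows "inj_on (\<lambda>v. v div 4) A"
proof (rule inj_onI, rule ccontr)
  fix v v' assume v: "v \<in> A" "v' \<in> A" "v div 4 = v' div 4" "v \<noteq> v'"
  then have mod: "v mod 4 \<noteq> v' mod 4" by (metis div_mult_mod_eq)
  have r: "v div 4 < 3" using v assms(1) by auto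
  have B: "w div 4 < 3" if "w \<in> B" for w using that assms(2) by auto
  have eq: "entry v (w div 4) = entry v' (w div 4)" if "w \<in> B" for w
    using opp[OF v(1) that] opp[OF v(2) that] v(3) entry_cases by metis
  obtain w0 where w0: "w0 \<in> B" using assms(3) by fastforce
  have c: "w div 4 = w0 div 4" if "w \<in> B" for w
    by (rule entry_agree_unique[OF mod B B eq eq]) (use that w0 in auto)
  have "B \<subseteq> (\<lambda>a. 4 * (w0 div 4) + a) ` {a. a < 4 \<and> entry a (v div 4) = entry w0 (v div 4)}"
  proof
    fix w assume w: "w \<in> B"
    have "entry w (v div 4) = entry w0 (v div 4)"
      using opp[OF v(1) w] opp[OF v(1) w0] c[OF w] entry_cases by metis
    then have "entry (w mod 4) (v div 4) = entry w0 (v div 4)" by (simp add: entry_def)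
    moreover have "w = 4 * (w0 div 4) + w mod 4" using c[OF w] by (metis mult_div_mod_eq)
    ultimately show "w \<in> (\<lambda>a. 4 * (w0 div 4) + a) ` {a. a < 4 \<and> entry a (v div 4) = entry w0 (v div 4)}"
      by auto
  qed
  then have "card B \<le> card {a. a < 4 \<and> entry a (v div 4) = entry w0 (v div 4)}"
    by (rule surj_card_le[rotated]) simp
  also have "\<dots> \<le> 2" by (rule entry_card[OF r])
  finally show False using assms(3) by simp
qed

lemma disagreeing_no_biclique:
  assumes A: "A \<subseteq> {..<12}" "3 \<le> card A" and B: "B \<subseteq> {..<12}" "3 \<le> card B"
  shows "\<not> A \<times> B \<subseteq> disagreeing"
proof
  assume "A \<times> B \<subseteq> disagreeing"
  then have opp: "entry v (w div 4) \<noteq> entry w (v div 4)" if "v \<in> A" "w \<in> B" for v w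
    using that by (auto simp: disagreeing_def)
  have onto: "\<exists>v\<in>C. v div 4 = r"
    if "C \<subseteq> {..<12}" "3 \<le> card C" "inj_on (\<lambda>v. v div 4) C" "r < 3" for C :: "nat set" and r :: nat
  proof -
    have "(\<lambda>v. v div 4) ` C = {..<3}"
      using that by (intro card_seteq) (auto simp: card_image)
    then have "r \<in> (\<lambda>v. v div 4) ` C" using that(4) by simp
    then show ?thesis by auto
  qed
  have "\<exists>v\<in>A. v div 4 = r" if "r < 3" for r
    using A B opp by (intro onto that biclique_inj_on[of A B]) auto
  then obtain x where x: "\<And>r. r < 3 \<Longrightarrow> x r \<in> A \<and> x r div 4 = r" by metis
  have "\<exists>w\<in>B. w div 4 = c" if "c < 3" for c
    using A B opp[symmetric] by (intro onto that biclique_inj_on[of B A]) auto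
  then obtain y where y: "\<And>c. c < 3 \<Longrightarrow> y c \<in> B \<and> y c div 4 = c" by metis
  have "entry (x r) c = - entry (y c) r" if "r < 3" "c < 3" for r c
    using opp[of "x r" "y c"] x[OF that(1)] y[OF that(2)] entry_cases by (metis minus_minus)
  \<comment> \<open>Multiplying all nine signs by rows gives 1, by columns (-1)^9; the factor
    \<open>- 1\<close> is written out so that \<open>prod.distrib\<close> can split it off.\<close>
  then have "(\<Prod>r\<in>{0, 1, 2}. \<Prod>c\<in>{0, 1, 2}. entry (x r) c) =
      (\<Prod>r\<in>{0, 1, 2}. \<Prod>c\<in>{0, 1, 2}. - 1 * entry (y c) r)"
    by (intro prod.cong refl) auto
  also have "\<dots> = - (\<Prod>r\<in>{0, 1, 2}. \<Prod>c\<in>{0, 1, 2}. entry (y c) r)"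
    unfolding prod.distrib by simp
  also have "\<dots> = - (\<Prod>c\<in>{0, 1, 2}. \<Prod>r\<in>{0, 1, 2}. entry (y c) r)"
    by (subst prod.swap) (rule refl)
  finally have "(\<Prod>r\<in>{0, 1, 2}. \<Prod>c\<in>{0, 1, 2}. entry (x r) c) = \<dots>" .
  moreover have "(\<Prod>c\<in>{0, 1, 2}. entry v c) = 1" for v
    using entry_prod[of v] by (simp add: mult.assoc)
  ultimately show False by simp
qed

lemma not_loc_isomorphic: "\<not> loc_isomorphic {..<12} {..<12} agreeing disagreeing"
proof
  assume "loc_isomorphic {..<12::nat} {..<12::nat} agreeing disagreeing"
  then obtain A B where "A \<subseteq> {..<12}" "B \<subseteq> {..<12}"
    "card {0, 4, 8::nat} \<le> card A" "card {0, 4, 8::nat} \<le> card B" "A \<times> B \<subseteq> disagreeing"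
  proof (rule loc_isomorphic_biclique[rotated 2])
    \<comment> \<open>These are the all-positive vectors of the three rows and of the three
      columns.\<close>
    show "{0, 4, 8} \<times> {0, 4, 8} \<subseteq> agreeing"
      by (auto simp: agreeing_def entry_def)
  qed auto
  then show False using disagreeing_no_biclique[of A B] by simp
qed

section \<open>The quantum strategy\<close>

text \<open>The correlation of the quantum strategy in closed form. The players measure even vectors
  s and t with opposite signs at the common cell and answer \<open>v1\<close> = s \<open>v2\<close>
  and \<open>w2\<close> = t \<open>w1\<close>, coordinatewise within the block; possible answers
  have probability 1/8.\<close>

definition strategy_kernel :: "nat \<times> nat \<Rightarrow> nat \<times> nat \<Rightarrow> complex" where
  "strategy_kernel = (\<lambda>(v1, w2) (v2, w1).
     if v1 div 4 = v2 div 4 \<and> w1 div 4 = w2 div 4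
     then (1 - entry v1 (w1 div 4) * entry v2 (w1 div 4) *
        (entry w1 (v1 div 4) * entry w2 (v1 div 4))) / 16
     else 0)"

text \<open>By this symmetry, unitality follows from trace preservation, and the dual map is the map
  itself.\<close>

lemma strategy_kernel_commute: "strategy_kernel x y = strategy_kernel y x"
  by (auto simp: strategy_kernel_def mult_ac split: prod.splits)

lemma strategy_kernel_nonneg: "0 \<le> strategy_kernel x y"
proof -
  obtain v1 w2 v2 w1 where [simp]: "x = (v1, w2)" "y = (v2, w1)" by fastforce
  show ?thesis
    using entry_cases[of v1 "w1 div 4"] entry_cases[of v2 "w1 div 4"]
      entry_cases[of w1 "v1 div 4"] entry_cases[of w2 "v1 div 4"]
    by (auto simp: strategy_kernel_def less_eq_complex_def)
qed

text \<open>Among the four even vectors each coordinate takes each sign twice, so the linear part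
  cancels. Both the marginals of the correlation and the row sums of the operator squares reduce to
  this.\<close>

lemma sum_block_all:
  fixes x :: complex
  assumes "r < 3"
  shows "(\<Sum>v<12. if v div 4 = r then x + (\<Sum>c<3. entry v c * y c) else 0) = 4 * x"
  using less_3_cases[OF assms]
  by (elim disjE) (simp_all add: lessThan_nat_numeral lessThan_Suc entry_def)

lemma sum_block:
  fixes x y :: complex
  assumes "r < 3" "c < 3"
  shows "(\<Sum>v<12. if v div 4 = r then x + entry v c * y else 0) = 4 * x"
  using sum_block_all[OF assms(1), of x "\<lambda>d. if d = c then y else 0"] assms(2)
  by (simp add: if_distrib[of "(*) _"] cong: if_cong)

text \<open>On a block the kernel is affine in a single sign of \<open>v1\<close>. That the value is
  free of \<open>v2\<close> is one of the no-signalling conditions.\<close>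

lemma sum_strategy_kernel_left:
  assumes "w1 < 12" "w2 < 12" "v2 < 12"
  shows "(\<Sum>v1<12. strategy_kernel (v1, w2) (v2, w1)) = (if w1 div 4 = w2 div 4 then 1 / 4 else 0)"
proof (cases "w1 div 4 = w2 div 4")
  case True
  have "(\<Sum>v1<12. strategy_kernel (v1, w2) (v2, w1)) =
      (\<Sum>v1<12. if v1 div 4 = v2 div 4 then 1 / 16 + entry v1 (w1 div 4) *
        (- entry v2 (w1 div 4) * (entry w1 (v2 div 4) * entry w2 (v2 div 4)) / 16) else 0)"
    using True by (intro sum.cong refl) (simp add: strategy_kernel_def diff_divide_distrib mult_ac)
  also have "\<dots> = 4 * (1 / 16)"
    using assms by (intro sum_block) auto
  finally show ?thesis using True by simp
qed (simp add: strategy_kernel_def)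

lemma sum_strategy_kernel_right:
  assumes "v1 < 12" "v2 < 12" "w1 < 12"
  shows "(\<Sum>w2<12. strategy_kernel (v1, w2) (v2, w1)) = (if v1 div 4 = v2 div 4 then 1 / 4 else 0)"
proof (cases "v1 div 4 = v2 div 4")
  case True
  have "(\<Sum>w2<12. strategy_kernel (v1, w2) (v2, w1)) =
      (\<Sum>w2<12. if w2 div 4 = w1 div 4 then 1 / 16 + entry w2 (v1 div 4) *
        (- entry v1 (w1 div 4) * entry v2 (w1 div 4) * entry w1 (v1 div 4) / 16) else 0)"
    using True by (intro sum.cong refl) (simp add: strategy_kernel_def diff_divide_distrib mult_ac)
  also have "\<dots> = 4 * (1 / 16)"
    using assms by (intro sum_block) auto
  finally show ?thesis using True by simp
qed (simp add: strategy_kernel_def)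

lemma sum_strategy_kernel:
  assumes "u \<in> {..<12} \<times> {..<12}"
  shows "(\<Sum>x\<in>{..<12} \<times> {..<12}. strategy_kernel x u) = 1"
proof -
  obtain v2 w1 where u: "u = (v2, w1)" "v2 < 12" "w1 < 12" using assms by auto
  have "(\<Sum>x\<in>{..<12} \<times> {..<12}. strategy_kernel x u) =
      (\<Sum>v1<12. \<Sum>w2<12. strategy_kernel (v1, w2) (v2, w1))"
    by (simp add: u sum.cartesian_product)
  \<comment> \<open>The zero summand gives the shape required by \<open>sum_block\<close>.\<close>
  also have "\<dots> = (\<Sum>v1<12. if v1 div 4 = v2 div 4 then 1 / 4 + entry v1 0 * 0 else 0)"
    using u by (intro sum.cong refl) (simp add: sum_strategy_kernel_right)
  also have "\<dots> = 4 * (1 / 4)" using u by (intro sum_block) auto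
  finally show ?thesis by simp
qed

section \<open>The strategy as a no-signalling bicorrelation\<close>

definition strategy_map :: "(nat \<times> nat) cmatrix \<Rightarrow> (nat \<times> nat) cmatrix" where
  "strategy_map = kernel_map ({..<12} \<times> {..<12}) ({..<12} \<times> {..<12}) strategy_kernel"

lemma kernel_strategy_map:
  "v1 < 12 \<Longrightarrow> w2 < 12 \<Longrightarrow> v2 < 12 \<Longrightarrow> w1 < 12 \<Longrightarrow>
    kernel strategy_map (v1, w2) (v2, w1) = strategy_kernel (v1, w2) (v2, w1)"
  by (simp add: strategy_map_def kernel_kernel_map)

lemma ns_correlation_strategy_map: "ns_correlation {..<12} {..<12} {..<12} {..<12} strategy_map"
  unfolding ns_correlation_def
proof (intro conjI ballI)
  show "channel ({..<12} \<times> {..<12}) ({..<12} \<times> {..<12}) strategy_map"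
    unfolding strategy_map_def
    by (intro channel_kernel_map sum_strategy_kernel strategy_kernel_nonneg) auto
qed (simp_all add: kernel_strategy_map sum_strategy_kernel_left sum_strategy_kernel_right)

lemma ns_bicorrelation_strategy_map: "ns_bicorrelation {..<12} {..<12} strategy_map"
proof -
  have "strategy_map (id_cmatrix ({..<12} \<times> {..<12})) = id_cmatrix ({..<12} \<times> {..<12})"
  proof (intro ext)
    fix x y :: "nat \<times> nat"
    have "(\<Sum>v\<in>{..<12} \<times> {..<12}. strategy_kernel x v * id_cmatrix ({..<12} \<times> {..<12}) v v) = 1"
      if "x \<in> {..<12} \<times> {..<12}"
      using sum_strategy_kernel[OF that]
      by (simp add: id_cmatrix_def strategy_kernel_commute[of x])
    then have "strategy_map (id_cmatrix ({..<12} \<times> {..<12})) x y =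
        (if x = y \<and> x \<in> {..<12} \<times> {..<12} then 1 else 0)"
      unfolding strategy_map_def kernel_map_def by (intro if_cong refl) blast
    then show "strategy_map (id_cmatrix ({..<12} \<times> {..<12})) x y = id_cmatrix ({..<12} \<times> {..<12}) x y"
      by (simp only: id_cmatrix_def)
  qed
  moreover have "dual_map ({..<12} \<times> {..<12}) ({..<12} \<times> {..<12}) strategy_map = strategy_map"
  proof -
    have "(\<lambda>x y. strategy_kernel y x) = strategy_kernel"
      by (intro ext strategy_kernel_commute)
    then show ?thesis by (simp add: strategy_map_def dual_map_kernel_map)
  qed
  ultimately show ?thesis
    using ns_correlation_strategy_map by (simp add: ns_bicorrelation_def)
qed

text \<open>Outside \<open>hyp_iff\<close> both pairs agree or both disagree at their cells. Within
  the blocks the product of the four signs is then 1, and the numerator of the kernel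
  vanishes.\<close>

lemma supported_strategy_map: "supported_on_iff {..<12} {..<12} agreeing disagreeing strategy_map"
  unfolding supported_on_iff_def
proof (intro ballI impI)
  fix v2 w1 v1 w2 :: nat
  assume lt: "v2 \<in> {..<12}" "w1 \<in> {..<12}" "v1 \<in> {..<12}" "w2 \<in> {..<12}"
    and "(v2, w1, v1, w2) \<notin> hyp_iff {..<12} {..<12} agreeing disagreeing"
  then have "entry v1 (w1 div 4) = entry w1 (v1 div 4) \<longleftrightarrow> entry v2 (w2 div 4) = entry w2 (v2 div 4)"
    by (simp add: hyp_iff_def agreeing_def disagreeing_def)
  then show "kernel strategy_map (v1, w2) (v2, w1) = 0"
    using lt entry_cases[of v1 "w1 div 4"] entry_cases[of v2 "w2 div 4"]
      entry_cases[of w1 "v1 div 4"] entry_cases[of w2 "v2 div 4"]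
    by (auto simp: kernel_strategy_map strategy_kernel_def)
qed

section \<open>Pauli observables and the quantum magic squares\<close>

type_synonym observable = "nat \<Rightarrow> nat \<Rightarrow> complex"

definition pauli_1 :: observable where "pauli_1 i j = (if i = j then 1 else 0)"
definition pauli_X :: observable where "pauli_X i j = (if i = j then 0 else 1)"
definition pauli_Z :: observable where "pauli_Z i j = (if i = j then if i = 0 then 1 else - 1 else 0)"
text \<open>This is -iY. Being real, it lets every observable of the square be a real symmetric
  matrix, so the transpose coming from the maximally entangled vector has no effect.\<close>

definition pauli_XZ :: observable where "pauli_XZ i j = (if i = j then 0 else if i = 0 then - 1 else 1)"

definition pauli_tensor :: "observable \<Rightarrow> observable \<Rightarrow> observable" where
  "pauli_tensor S T i j = S (i div 2) (j div 2) * T (i mod 2) (j mod 2)"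

text \<open>A Mermin--Peres square: every row commutes and has product $I$, every column commutes and
  has product $-I$. The last entry is $Y \otimes Y = -XZ \otimes XZ$.\<close>

definition magic :: "nat \<Rightarrow> nat \<Rightarrow> observable" where
  "magic r c i j =
    [[- pauli_tensor pauli_X pauli_1 i j, - pauli_tensor pauli_1 pauli_X i j, pauli_tensor pauli_X pauli_X i j],
     [pauli_tensor pauli_1 pauli_Z i j, pauli_tensor pauli_Z pauli_1 i j, pauli_tensor pauli_Z pauli_Z i j],
     [pauli_tensor pauli_X pauli_Z i j, pauli_tensor pauli_Z pauli_X i j, - pauli_tensor pauli_XZ pauli_XZ i j]] ! r ! c"

text \<open>Negating the observables turns the column products into $I$.\<close>

definition magic_dual :: "nat \<Rightarrow> nat \<Rightarrow> observable" where
  "magic_dual c r i j = - magic r c i j"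

text \<open>For signs \<open>s\<close> with product $1$ this is the projection onto the joint eigenspace of three
  commuting observables with product $I$.\<close>

definition eigenproj :: "(nat \<Rightarrow> observable) \<Rightarrow> (nat \<Rightarrow> complex) \<Rightarrow> observable" where
  "eigenproj M s i j = ((if i = j then 1 else 0) + (\<Sum>c<3. s c * M c i j)) / 4"

text \<open>Block diagonal in the rows of the game; inside a block it is the multiplication table of
  the group of even sign vectors, each entry replaced by its eigenprojection. Every row and column
  thus lists each projection once.\<close>

definition strategy_square :: "(nat \<Rightarrow> nat \<Rightarrow> observable) \<Rightarrow> nat \<Rightarrow> nat \<Rightarrow> complex mat" where
  "strategy_square M v v' = mat 4 4 (\<lambda>(i, j).
     if v div 4 = v' div 4 then eigenproj (M (v div 4)) (\<lambda>c. entry v c * entry v' c) i j else 0)"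

lemma strategy_square_commute: "strategy_square M v v' = strategy_square M v' v"
  by (rule eq_matI) (auto simp: strategy_square_def mult.commute)

lemmas pauli_defs = pauli_1_def pauli_X_def pauli_Z_def pauli_XZ_def pauli_tensor_def

lemma sum_lessThan_3: "(\<Sum>k<3. f k) = f 0 + f 1 + f (2::nat)"
  by (simp add: eval_nat_numeral)

lemma sum_lessThan_4: "(\<Sum>k<4. f k) = f 0 + f 1 + f 2 + f (3::nat)"
  by (simp add: eval_nat_numeral)

text \<open>Since the observables commute with product I, the matrix is the product of (I + s_0
  M_0)/2 and (I + s_1 M_1)/2, an orthogonal projection. The proof checks all entries and
  signs.\<close>

lemma eigenproj_magic_Gram:
  assumes "r < 3" "i < 4" "j < 4" and s: "s 0 \<in> {1, - 1}" "s 1 \<in> {1, - 1}" "s 2 = s 0 * s 1"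
    and "M = magic r \<or> M = magic_dual r"
  shows "eigenproj M s i j = (\<Sum>k<4. cnj (eigenproj M s k i) * eigenproj M s k j)"
  using less_3_cases[OF assms(1)] less_4_cases[OF assms(2)] less_4_cases[OF assms(3)] assms(7)
  unfolding sum_lessThan_4 eigenproj_def sum_lessThan_3
  by (elim disjE; hypsubst; simp add: magic_dual_def magic_def pauli_defs;
      insert s; elim insertE emptyE; simp)

text \<open>The nine observables are, up to sign, distinct nontrivial Pauli tensors and so
  trace-orthogonal. Only the identity terms and the common cell contribute;
  \<open>magic_dual\<close> supplies the minus sign.\<close>

lemma eigenproj_magic_inner:
  assumes "r < 3" "c < 3"
  shows "(\<Sum>i<4. \<Sum>j<4. eigenproj (magic r) s i j * eigenproj (magic_dual c) t i j) =
    (1 - s c * t r) / 4"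
  using less_3_cases[OF assms(1)] less_3_cases[OF assms(2)]
  unfolding sum_lessThan_4 eigenproj_def sum_lessThan_3
  by (elim disjE; hypsubst; simp add: magic_dual_def magic_def pauli_defs; simp add: field_simps)

lemma quantum_magic_square_strategy:
  assumes "\<And>r. r < 3 \<Longrightarrow> M r = magic r \<or> M r = magic_dual r"
  shows "quantum_magic_square {..<12} 4 (strategy_square M)"
proof -
  have pos: "positive_op 4 (strategy_square M v v')" if "v < 12" "v' < 12" for v v'
  proof (cases "v div 4 = v' div 4")
    case True
    let ?s = "\<lambda>c. entry v c * entry v' c"
    have "?s 0 \<in> {1, - 1}" "?s 1 \<in> {1, - 1}"
      using entry_cases[of v] entry_cases[of v'] by (metis insert_iff minus_minus mult_1 mult_minus1)+
    moreover have "entry u 2 = entry u 0 * entry u 1" for u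
      using less_4_cases[of "u mod 4"] by (auto simp: entry_def)
    then have "?s 2 = ?s 0 * ?s 1" by (simp add: mult_ac)
    moreover have "v div 4 < 3" using that by auto
    ultimately have "positive_op 4 (mat 4 4 (\<lambda>(i, j). eigenproj (M (v div 4)) ?s i j))"
      using assms by (intro positive_op_Gram eigenproj_magic_Gram) auto
    then show ?thesis using True by (simp add: strategy_square_def)
  next
    case False
    \<comment> \<open>Off the blocks the matrix is zero and the Gram condition is trivial.\<close>
    then show ?thesis
      unfolding strategy_square_def by (simp only: if_False) (rule positive_op_Gram, simp)
  qed
  have row: "op_sum 4 (strategy_square M v) {..<12} = 1\<^sub>m 4" if "v < 12" for v
  proof (rule eq_matI)
    fix i j assume ij: "i < dim_row (1\<^sub>m 4 :: complex mat)" "j < dim_col (1\<^sub>m 4 :: complex mat)"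
    let ?y = "\<lambda>c. entry v c * M (v div 4) c i j / 4"
    have "op_sum 4 (strategy_square M v) {..<12} $$ (i, j) =
        (\<Sum>v'<12. strategy_square M v v' $$ (i, j))"
      using ij by (simp add: op_sum_def)
    also have "\<dots> = (\<Sum>v'<12. if v' div 4 = v div 4
        then (if i = j then 1 / 4 else 0) + (\<Sum>c<3. entry v' c * ?y c) else 0)"
      using ij by (intro sum.cong refl)
        (auto simp: strategy_square_def eigenproj_def add_divide_distrib sum_divide_distrib mult_ac)
    also have "\<dots> = 4 * (if i = j then 1 / 4 else 0)"
      using that by (intro sum_block_all) auto
    finally show "op_sum 4 (strategy_square M v) {..<12} $$ (i, j) = 1\<^sub>m 4 $$ (i, j)"
      using ij by simp
  qed (simp_all add: op_sum_def)
  then have "op_sum 4 (\<lambda>v. strategy_square M v v') {..<12} = 1\<^sub>m 4" if "v' < 12" for v'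
    using that by (simp add: strategy_square_commute[of M _ v'])
  with pos row show ?thesis by (simp add: quantum_magic_square_def)
qed

lemma strategy_kernel_quantum:
  assumes "v1 < 12" "v2 < 12" "w1 < 12" "w2 < 12"
  shows "strategy_kernel (v1, w2) (v2, w1) =
    (tensor_mat (strategy_square magic v2 v1) (strategy_square magic_dual w1 w2) *\<^sub>v max_entangled 4)
      \<bullet>c max_entangled 4"
proof -
  have sq: "strategy_square M v v' \<in> carrier_mat 4 4" for M v v'
    by (simp add: strategy_square_def)
  have "(tensor_mat (strategy_square magic v2 v1) (strategy_square magic_dual w1 w2) *\<^sub>v max_entangled 4)
      \<bullet>c max_entangled 4 =
      (\<Sum>i<4. \<Sum>j<4. strategy_square magic v2 v1 $$ (i, j) * strategy_square magic_dual w1 w2 $$ (i, j)) / 4"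
    by (simp add: tensor_mat_max_entangled[OF sq sq])
  also have "\<dots> = strategy_kernel (v1, w2) (v2, w1)"
  proof (cases "v1 div 4 = v2 div 4 \<and> w1 div 4 = w2 div 4")
    case True
    have "(\<Sum>i<4. \<Sum>j<4. strategy_square magic v2 v1 $$ (i, j) * strategy_square magic_dual w1 w2 $$ (i, j)) =
        (\<Sum>i<4. \<Sum>j<4. eigenproj (magic (v1 div 4)) (\<lambda>c. entry v2 c * entry v1 c) i j *
          eigenproj (magic_dual (w1 div 4)) (\<lambda>r. entry w1 r * entry w2 r) i j)"
      using True by (intro sum.cong refl) (simp add: strategy_square_def)
    also have "\<dots> = (1 - entry v2 (w1 div 4) * entry v1 (w1 div 4) *
        (entry w1 (v1 div 4) * entry w2 (v1 div 4))) / 4"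
      using assms by (intro eigenproj_magic_inner) auto
    finally show ?thesis using True by (simp add: strategy_kernel_def mult_ac)
  next
    case False
    then have "strategy_square magic v2 v1 $$ (i, j) * strategy_square magic_dual w1 w2 $$ (i, j) = 0"
      if "i < 4" "j < 4" for i j
      using that by (auto simp: strategy_square_def)
    then have "(\<Sum>i<4. \<Sum>j<4. strategy_square magic v2 v1 $$ (i, j) * strategy_square magic_dual w1 w2 $$ (i, j)) = 0"
      by (intro sum.neutral ballI) simp
    then show ?thesis using False by (simp only: strategy_kernel_def split) auto
  qed
  finally show ?thesis ..
qed

section \<open>The quantum isomorphism and the separation\<close>

lemma q_isomorphic_agreeing: "q_isomorphic {..<12} {..<12} agreeing disagreeing"
  unfolding q_isomorphic_def quantum_bicorrelation_def
proof (intro exI conjI)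
  show "quantum_magic_square {..<12} 4 (strategy_square magic)"
    "quantum_magic_square {..<12} 4 (strategy_square magic_dual)"
    by (rule quantum_magic_square_strategy, simp)+
  show "max_entangled 4 \<in> carrier_vec (4 * 4)" by (simp add: max_entangled_def)
  show "max_entangled 4 \<bullet>c max_entangled 4 = 1" by (rule max_entangled_unit) simp
  show "\<forall>v1\<in>{..<12}. \<forall>w2\<in>{..<12}. \<forall>v2\<in>{..<12}. \<forall>w1\<in>{..<12}.
      kernel strategy_map (v1, w2) (v2, w1) =
      (tensor_mat (strategy_square magic v2 v1) (strategy_square magic_dual w1 w2) *\<^sub>v max_entangled 4)
        \<bullet>c max_entangled 4"
    by (simp add: kernel_strategy_map strategy_kernel_quantum)
qed (rule ns_bicorrelation_strategy_map supported_strategy_map)+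

theorem corollary4p17:
  shows "\<exists>(V :: nat set) (W :: nat set) E1 E2.
    finite V \<and> finite W \<and> hypergraph V W E1 \<and> hypergraph V W E2 \<and>
    q_isomorphic V W E1 E2 \<and> \<not> loc_isomorphic V W E1 E2"
proof -
  have "hypergraph {..<12} {..<12} agreeing" "hypergraph {..<12} {..<12} disagreeing"
    by (auto simp: hypergraph_def agreeing_def disagreeing_def)
  then show ?thesis
    using q_isomorphic_agreeing not_loc_isomorphic by blast
qed

end
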